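(* Given a set $P$ of $n$ points in the plane $\mathbb{R}^2$, a $1$-ply unit square cover of $P$ can be computed in $O(n\log n)$ time.
   Context: A unit square is a closed axis-aligned square $[a,a+1]\times[b,b+1]$, $a,b\in\mathbb{R}$. For a set $\mathcal{S}$ of geometric objects in the plane, $\mathsf{ply}(\mathcal{S})=\max_{p\in\mathbb{R}^2}|\{s\in\mathcal{S}: p\in s\}|$. A $1$-ply unit square cover of $P$ is a finite set $\mathcal{S}$ of unit squares whose union contains $P$ and with $\mathsf{ply}(\mathcal{S})\le 1$, i.e. the squares are pairwise disjoint (they do not even touch). The squares may be placed anywhere in the plane. *)

theory Defs
  imports Complex_Main "HOL-Library.Landau_Symbols"
begin

section \<open>Ply and unit square covers\<close>

type_synonym point = "real \<times> real"

definition unit_square :: "point \<Rightarrow> point set" where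
  "unit_square q = {fst q .. fst q + 1} \<times> {snd q .. snd q + 1}"

text \<open>The maximum exists whenever \<open>S\<close> is finite; for infinite \<open>S\<close> the value may be meaningless.\<close>

definition ply :: "point set set \<Rightarrow> nat" where
  "ply S = Max (range (\<lambda>p. card {s \<in> S. p \<in> s}))"

definition one_ply_unit_square_cover :: "point set \<Rightarrow> point set set \<Rightarrow> bool" where
  "one_ply_unit_square_cover P S \<longleftrightarrow>
     finite S \<and> (\<forall>s\<in>S. \<exists>q. s = unit_square q) \<and> P \<subseteq> \<Union>S \<and> ply S \<le> 1"


section \<open>A real RAM\<close>

text \<open>
  Running time is measured on a real RAM, programmed in a deeply embedded while language. The
  machine has scalar registers and random access arrays, each holding either natural numbers or
  exact real numbers; a program, being a finite term, mentions only finitely many of them. The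
  operations on natural numbers are addition and truncated subtraction; the operations on reals
  are the four field operations. There is no rounding and no other way of turning reals into
  natural numbers except by branching on comparisons. Real constants in programs are restricted
  to integers, so that a program cannot carry unbounded information in a constant.

  Every constant, variable access, array access, arithmetic operation, comparison, connective,
  assignment and branch has unit cost.
\<close>

record state =
  nreg :: "nat \<Rightarrow> nat"
  rreg :: "nat \<Rightarrow> real"
  narr :: "nat \<Rightarrow> nat \<Rightarrow> nat"
  rarr :: "nat \<Rightarrow> nat \<Rightarrow> real"

datatype nexp =
    NConst nat
  | NReg nat
  | NArr nat nexp
  | NAdd nexp nexp
  | NSub nexp nexp

datatype rexp =
    RConst int
  | RReg nat
  | RArr nat nexp
  | RAdd rexp rexp
  | RSub rexp rexp
  | RMul rexp rexp
  | RDiv rexp rexp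

datatype bexp =
    NLess nexp nexp
  | RLess rexp rexp
  | BNot bexp
  | BAnd bexp bexp

datatype com =
    Skip
  | NAssign nat nexp
  | RAssign nat rexp
  | NStore nat nexp nexp
  | RStore nat nexp rexp
  | Seq com com
  | Cond bexp com com
  | While bexp com

primrec nval :: "nexp \<Rightarrow> state \<Rightarrow> nat" where
  "nval (NConst k) s = k"
| "nval (NReg x) s = nreg s x"
| "nval (NArr a e) s = narr s a (nval e s)"
| "nval (NAdd e f) s = nval e s + nval f s"
| "nval (NSub e f) s = nval e s - nval f s"

text \<open>Division by zero returns zero, as usual in HOL.\<close>

primrec rval :: "rexp \<Rightarrow> state \<Rightarrow> real" where
  "rval (RConst k) s = of_int k"
| "rval (RReg x) s = rreg s x"
| "rval (RArr a e) s = rarr s a (nval e s)"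
| "rval (RAdd e f) s = rval e s + rval f s"
| "rval (RSub e f) s = rval e s - rval f s"
| "rval (RMul e f) s = rval e s * rval f s"
| "rval (RDiv e f) s = rval e s / rval f s"

primrec bval :: "bexp \<Rightarrow> state \<Rightarrow> bool" where
  "bval (NLess e f) s \<longleftrightarrow> nval e s < nval f s"
| "bval (RLess e f) s \<longleftrightarrow> rval e s < rval f s"
| "bval (BNot b) s \<longleftrightarrow> \<not> bval b s"
| "bval (BAnd b c) s \<longleftrightarrow> bval b s \<and> bval c s"

primrec ncost :: "nexp \<Rightarrow> nat" where
  "ncost (NConst k) = 1"
| "ncost (NReg x) = 1"
| "ncost (NArr a e) = ncost e + 1"
| "ncost (NAdd e f) = ncost e + ncost f + 1"
| "ncost (NSub e f) = ncost e + ncost f + 1"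

primrec rcost :: "rexp \<Rightarrow> nat" where
  "rcost (RConst k) = 1"
| "rcost (RReg x) = 1"
| "rcost (RArr a e) = ncost e + 1"
| "rcost (RAdd e f) = rcost e + rcost f + 1"
| "rcost (RSub e f) = rcost e + rcost f + 1"
| "rcost (RMul e f) = rcost e + rcost f + 1"
| "rcost (RDiv e f) = rcost e + rcost f + 1"

primrec bcost :: "bexp \<Rightarrow> nat" where
  "bcost (NLess e f) = ncost e + ncost f + 1"
| "bcost (RLess e f) = rcost e + rcost f + 1"
| "bcost (BNot b) = bcost b + 1"
| "bcost (BAnd b c) = bcost b + bcost c + 1"

text \<open>
  \<open>exec c s t s'\<close>: started in state \<open>s\<close>, the program \<open>c\<close> halts in state \<open>s'\<close> after exactly
  \<open>t\<close> time units.
\<close>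

inductive exec :: "com \<Rightarrow> state \<Rightarrow> nat \<Rightarrow> state \<Rightarrow> bool" where
  Skip: "exec Skip s 1 s"
| NAssign: "exec (NAssign x e) s (ncost e + 1) (s\<lparr>nreg := (nreg s)(x := nval e s)\<rparr>)"
| RAssign: "exec (RAssign x e) s (rcost e + 1) (s\<lparr>rreg := (rreg s)(x := rval e s)\<rparr>)"
| NStore: "exec (NStore a i e) s (ncost i + ncost e + 1)
    (s\<lparr>narr := (narr s)(a := (narr s a)(nval i s := nval e s))\<rparr>)"
| RStore: "exec (RStore a i e) s (ncost i + rcost e + 1)
    (s\<lparr>rarr := (rarr s)(a := (rarr s a)(nval i s := rval e s))\<rparr>)"
| Seq: "exec c s t s' \<Longrightarrow> exec d s' u s'' \<Longrightarrow> exec (Seq c d) s (t + u) s''"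
| CondTrue: "bval b s \<Longrightarrow> exec c s t s' \<Longrightarrow> exec (Cond b c d) s (bcost b + 1 + t) s'"
| CondFalse: "\<not> bval b s \<Longrightarrow> exec d s t s' \<Longrightarrow> exec (Cond b c d) s (bcost b + 1 + t) s'"
| WhileFalse: "\<not> bval b s \<Longrightarrow> exec (While b c) s (bcost b + 1) s"
| WhileTrue: "bval b s \<Longrightarrow> exec c s t s' \<Longrightarrow> exec (While b c) s' u s'' \<Longrightarrow>
    exec (While b c) s (bcost b + 1 + t + u) s''"

inductive_cases exec_SkipE: "exec Skip s t s'"
inductive_cases exec_NAssignE: "exec (NAssign x e) s t s'"
inductive_cases exec_RAssignE: "exec (RAssign x e) s t s'"
inductive_cases exec_NStoreE: "exec (NStore a i e) s t s'"
inductive_cases exec_RStoreE: "exec (RStore a i e) s t s'"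
inductive_cases exec_SeqE: "exec (Seq c d) s t s'"
inductive_cases exec_CondE: "exec (Cond b c d) s t s'"
inductive_cases exec_WhileE: "exec (While b c) s t s'"

lemma exec_deterministic:
  "exec c s t s' \<Longrightarrow> exec c s u s'' \<Longrightarrow> u = t \<and> s'' = s'"
proof (induction arbitrary: u s'' rule: exec.induct)
  case Skip
  then show ?case by (auto elim: exec_SkipE)
next
  case NAssign
  then show ?case by (auto elim: exec_NAssignE)
next
  case RAssign
  then show ?case by (auto elim: exec_RAssignE)
next
  case NStore
  then show ?case by (auto elim: exec_NStoreE)
next
  case RStore
  then show ?case by (auto elim: exec_RStoreE)
next
  case (Seq c s t s' d v s1)
  from Seq.prems obtain t' v' r where r: "exec c s t' r" "exec d r v' s''" "u = t' + v'"
    by (rule exec_SeqE)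
  from Seq.IH(1)[OF r(1)] Seq.IH(2) r(2,3) show ?case by simp
next
  case (CondTrue b s c t s' d)
  from CondTrue.prems CondTrue.hyps(1) obtain t' where r: "exec c s t' s''" "u = bcost b + 1 + t'"
    by (auto elim: exec_CondE)
  from CondTrue.IH[OF r(1)] r(2) show ?case by simp
next
  case (CondFalse b s d t s' c)
  from CondFalse.prems CondFalse.hyps(1) obtain t' where r: "exec d s t' s''" "u = bcost b + 1 + t'"
    by (auto elim: exec_CondE)
  from CondFalse.IH[OF r(1)] r(2) show ?case by simp
next
  case (WhileFalse b s c)
  from WhileFalse.prems WhileFalse.hyps show ?case by (auto elim: exec_WhileE)
next
  case (WhileTrue b s c t s' v s1)
  from WhileTrue.prems WhileTrue.hyps(1) obtain t' v' r where
    r: "exec c s t' r" "exec (While b c) r v' s''" "u = bcost b + 1 + t' + v'"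
    by (auto elim: exec_WhileE[of b c s u s''])
  from WhileTrue.IH(1)[OF r(1)] WhileTrue.IH(2) r(2,3) show ?case by simp
qed


section \<open>Input and output\<close>

text \<open>
  A finite set of points is presented to and returned by the machine as a repetition-free list of
  points in arbitrary order, stored as the two sequences of coordinates together with its length.
  All memory cells outside the input are initially zero. A unit square is returned as its lower
  left corner.
\<close>

definition input_state :: "point list \<Rightarrow> state" where
  "input_state ps = \<lparr>
     nreg = (\<lambda>x. if x = 0 then length ps else 0),
     rreg = (\<lambda>x. 0),
     narr = (\<lambda>a i. 0),
     rarr = (\<lambda>a i. if i < length ps then
                     if a = 0 then fst (ps ! i) else if a = 1 then snd (ps ! i) else 0
                   else 0)\<rparr>"

definition output_list :: "state \<Rightarrow> point list" where
  "output_list s = map (\<lambda>i. (rarr s 2 i, rarr s 3 i)) [0..<nreg s 1]"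

definition computes_one_ply_cover_in_time :: "com \<Rightarrow> (nat \<Rightarrow> nat) \<Rightarrow> bool" where
  "computes_one_ply_cover_in_time c T \<longleftrightarrow>
     (\<forall>n P ps. finite P \<and> card P = n \<and> set ps = P \<and> distinct ps \<longrightarrow>
        (\<exists>t s. exec c (input_state ps) t s \<and> t \<le> T n \<and>
               distinct (output_list s) \<and>
               one_ply_unit_square_cover P (unit_square ` set (output_list s))))"

end

theory Submission
  imports Defs "HOL-Library.Product_Lexorder" "HOL-Real_Asymp.Real_Asymp"
begin

text \<open>
  Sweep from left to right and open a vertical strip of width 1 at the leftmost point that no
  earlier strip contains; consecutive strips then start more than 1 apart, so they are disjoint.
  Inside each strip the same greedy sweep from bottom to top yields disjoint unit squares. After
  sorting the points lexicographically, replacing each abscissa by that of the left edge of its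
  strip and sorting again, both sweeps take linear time, so merge sort dominates the cost.
\<close>

section \<open>A weakest precondition calculus with time credits\<close>

text \<open>The machine cannot round reals to integers, so points cannot be bucketed by a grid,
  whose neighbouring closed unit cells would touch anyway; comparisons along a sorted order take its
  place. Overwriting an abscissa by the left edge of its strip encodes membership in a strip as
  equality of reals. The first sort leaves the ordinates inside a strip in no particular order;
  after the overwriting, lexicographic order means strip by strip and upwards in each, so comparing
  a point with the last emitted corner alone decides whether it needs a new square. The sorts are
  specified only through images of index ranges: covering depends on the set of points alone, and
  overwriting may make distinct points coincide. The language has no recursion, hence a bottom-up
  merge sort that doubles the width of sorted blocks. Running time is proved together with
  correctness: every command pays its cost from a store of credits, and several loop budgets are
  round upper bounds rather than exact counts.\<close>

definition wp :: "com \<Rightarrow> (nat \<Rightarrow> state \<Rightarrow> bool) \<Rightarrow> nat \<Rightarrow> state \<Rightarrow> bool" where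
  "wp c Q k s \<longleftrightarrow> (\<exists>t s'. exec c s t s' \<and> t \<le> k \<and> Q (k - t) s')"

lemma exec_basic_iff:
  "exec Skip s t s' \<longleftrightarrow> t = 1 \<and> s' = s"
  "exec (NAssign x e) s t s' \<longleftrightarrow>
     t = ncost e + 1 \<and> s' = s\<lparr>nreg := (nreg s)(x := nval e s)\<rparr>"
  "exec (RAssign x d) s t s' \<longleftrightarrow>
     t = rcost d + 1 \<and> s' = s\<lparr>rreg := (rreg s)(x := rval d s)\<rparr>"
  "exec (RStore a e d) s t s' \<longleftrightarrow> t = ncost e + rcost d + 1 \<and>
     s' = s\<lparr>rarr := (rarr s)(a := (rarr s a)(nval e s := rval d s))\<rparr>"
  by (auto simp del: One_nat_def add_Suc_right
      elim!: exec_SkipE exec_NAssignE exec_RAssignE exec_RStoreE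
      intro: exec.Skip exec.NAssign exec.RAssign exec.RStore)

lemma wp_basic:
  "wp Skip Q k s \<longleftrightarrow> 1 \<le> k \<and> Q (k - 1) s"
  "wp (NAssign x e) Q k s \<longleftrightarrow> ncost e + 1 \<le> k \<and>
     Q (k - (ncost e + 1)) (s\<lparr>nreg := (nreg s)(x := nval e s)\<rparr>)"
  "wp (RAssign x d) Q k s \<longleftrightarrow> rcost d + 1 \<le> k \<and>
     Q (k - (rcost d + 1)) (s\<lparr>rreg := (rreg s)(x := rval d s)\<rparr>)"
  "wp (RStore a e d) Q k s \<longleftrightarrow> ncost e + rcost d + 1 \<le> k \<and>
     Q (k - (ncost e + rcost d + 1))
       (s\<lparr>rarr := (rarr s)(a := (rarr s a)(nval e s := rval d s))\<rparr>)"
  unfolding wp_def exec_basic_iff by blast+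

lemma wp_Seq: "wp (Seq c d) Q k s \<longleftrightarrow> wp c (wp d Q) k s"
proof
  assume "wp (Seq c d) Q k s"
  then obtain t s' where "exec (Seq c d) s t s'" "t \<le> k" "Q (k - t) s'"
    unfolding wp_def by blast
  moreover from this(1) obtain t1 t2 r where "exec c s t1 r" "exec d r t2 s'" "t = t1 + t2"
    by (rule exec_SeqE)
  ultimately show "wp c (wp d Q) k s"
    unfolding wp_def by (intro exI[of _ t1] exI[of _ r] exI[of _ t2] exI[of _ s'] conjI) auto
next
  assume "wp c (wp d Q) k s"
  then obtain t1 r t2 s' where "exec c s t1 r" "t1 \<le> k" "exec d r t2 s'" "t2 \<le> k - t1"
    "Q (k - t1 - t2) s'"
    unfolding wp_def by blast
  then show "wp (Seq c d) Q k s"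
    unfolding wp_def by (intro exI[of _ "t1 + t2"] exI[of _ s'] conjI) (auto intro: exec.Seq)
qed

lemma wp_Cond: "wp (Cond b c d) Q k s \<longleftrightarrow>
    bcost b + 1 \<le> k \<and> wp (if bval b s then c else d) Q (k - (bcost b + 1)) s" (is "?l \<longleftrightarrow> ?r")
proof
  assume ?l
  then obtain t s' where *: "exec (Cond b c d) s t s'" "t \<le> k" "Q (k - t) s'"
    unfolding wp_def by blast
  from *(1) obtain u where "exec (if bval b s then c else d) s u s'" "t = bcost b + 1 + u"
    by (auto elim: exec_CondE)
  with * show ?r unfolding wp_def by (intro conjI exI[of _ u] exI[of _ s']) auto
next
  assume r: ?r
  then obtain u s' where *: "exec (if bval b s then c else d) s u s'" "u \<le> k - (bcost b + 1)"
    "Q (k - (bcost b + 1) - u) s'"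
    unfolding wp_def by blast
  from *(1) have "exec (Cond b c d) s (bcost b + 1 + u) s'"
    using exec.CondTrue[of b s c u s' d] exec.CondFalse[of b s d u s' c] by presburger
  with * r show ?l unfolding wp_def
    by (intro exI[of _ "bcost b + 1 + u"] exI[of _ s'] conjI) auto
qed

text \<open>As equivalences these let the simplifier run loop-free code symbolically, subtracting
  exact costs on the way. Loops enter through \<open>wp_mono\<close> instead.\<close>

lemmas wp_simps = wp_basic wp_Seq wp_Cond

text \<open>The call rule: a subprogram verified once with a fixed budget \<open>B\<close> is used
  inside a larger store \<open>k\<close>. Its actual run may be cheaper, so the continuation may
  assume only that at least \<open>k - B\<close> credits remain.\<close>

lemma wp_mono:
  assumes "wp c (\<lambda>_. R) B s" "B \<le> k" "\<And>s' k'. R s' \<Longrightarrow> k - B \<le> k' \<Longrightarrow> Q k' s'"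
  shows "wp c Q k s"
proof -
  from assms(1) obtain t s' where "exec c s t s'" "t \<le> B" "R s'"
    unfolding wp_def by blast
  with assms(2) assms(3)[of s' "k - t"] show ?thesis
    unfolding wp_def by (intro exI[of _ t] exI[of _ s'] conjI) auto
qed

text \<open>Credits strictly decrease in every iteration, so they also serve as the variant.\<close>

lemma wp_While:
  assumes step: "\<And>k s. I k s \<Longrightarrow> bval b s \<Longrightarrow>
      bcost b + 1 \<le> k \<and> wp c I (k - (bcost b + 1)) s"
    and exit: "\<And>k s. I k s \<Longrightarrow> \<not> bval b s \<Longrightarrow> bcost b + 1 \<le> k \<and> R s"
    and "I k s"
  shows "wp (While b c) (\<lambda>_. R) k s"
  using \<open>I k s\<close>
proof (induction k arbitrary: s rule: less_induct)
  case (less k)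
  show ?case
  proof (cases "bval b s")
    case True
    from step[OF less.prems True] obtain t s' where
      *: "exec c s t s'" "t \<le> k - (bcost b + 1)" "I (k - (bcost b + 1) - t) s'" "bcost b + 1 \<le> k"
      unfolding wp_def by blast
    have "k - (bcost b + 1) - t < k" using *(4) by simp
    from less.IH[OF this *(3)] obtain u s'' where
      "exec (While b c) s' u s''" "u \<le> k - (bcost b + 1) - t" "R s''"
      unfolding wp_def by blast
    with * True show ?thesis unfolding wp_def
      by (intro exI[of _ "bcost b + 1 + t + u"] exI[of _ s''] conjI)
        (blast intro: exec.WhileTrue, use * in linarith, simp add: diff_diff_eq add.assoc)
  next
    case False
    with exit[OF less.prems] show ?thesis
      unfolding wp_def by (blast intro: exec.WhileFalse)
  qed
qed


section \<open>Merge sort\<close>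

text \<open>Loop invariant of a merge with read positions \<open>i\<close>, \<open>j\<close> and
  write position \<open>k\<close>. The balance \<open>k + mid = i + j\<close> says without
  subtraction that as many entries were written as read; \<open>b\<^sub>0\<close> remembers the
  target below \<open>lo\<close>, where earlier blocks already lie.\<close>

definition merging :: "(nat \<Rightarrow> 'a::linorder) \<Rightarrow> (nat \<Rightarrow> 'a) \<Rightarrow> nat \<Rightarrow> nat \<Rightarrow> nat \<Rightarrow>
    nat \<Rightarrow> nat \<Rightarrow> nat \<Rightarrow> (nat \<Rightarrow> 'a) \<Rightarrow> bool" where
  "merging a b\<^sub>0 lo mid hi i j k b \<longleftrightarrow>
     lo \<le> i \<and> i \<le> mid \<and> mid \<le> j \<and> j \<le> hi \<and> k + mid = i + j \<and>
     mono_on {lo..<mid} a \<and> mono_on {mid..<hi} a \<and>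
     b ` {lo..<k} = a ` ({lo..<i} \<union> {mid..<j}) \<and> mono_on {lo..<k} b \<and>
     (\<forall>p\<in>{lo..<k}. \<forall>q\<in>{i..<mid} \<union> {j..<hi}. b p \<le> a q) \<and> (\<forall>p<lo. b p = b\<^sub>0 p)"

lemma merging_init:
  assumes "lo \<le> mid" "mid \<le> hi" "mono_on {lo..<mid} a" "mono_on {mid..<hi} a"
  shows "merging a b lo mid hi lo mid lo b"
  using assms by (simp add: merging_def mono_on_def)

lemma mono_on_snoc:
  fixes b :: "nat \<Rightarrow> 'a::linorder"
  assumes "mono_on {lo..<k} b" "\<forall>p\<in>{lo..<k}. b p \<le> x"
  shows "mono_on {lo..<Suc k} (b(k := x))"
  using assms unfolding mono_on_def by (auto simp: less_Suc_eq)

lemma image_snoc: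
  fixes lo :: nat
  assumes "lo \<le> k"
  shows "(b(k := x)) ` {lo..<Suc k} = insert x (b ` {lo..<k})"
  using assms by (auto simp: atLeastLessThanSuc)

text \<open>\<open>a i\<close> bounds the rest of its own run by sortedness and the rest of the
  other run through that run's head \<open>a j\<close>; the guarded hypothesis allows the other run
  to be exhausted. Hence written entries stay below unread ones, which is what makes the next append
  monotone.\<close>

lemma merging_left:
  assumes m: "merging a b\<^sub>0 lo mid hi i j k b" and "i < mid" "j < hi \<Longrightarrow> a i \<le> a j"
  shows "merging a b\<^sub>0 lo mid hi (Suc i) j (Suc k) (b(k := a i))"
proof -
  note d = m[unfolded merging_def]
  have le: "lo \<le> k" using d by linarith
  have low: "a i \<le> a q" if "q \<in> {i..<mid} \<union> {j..<hi}" for q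
  proof (cases "q < mid")
    case True
    then show ?thesis using d that \<open>i < mid\<close> by (auto simp: mono_on_def)
  next
    case False
    with that have "j \<le> q" "q < hi" by auto
    moreover from this d have "a j \<le> a q" by (auto simp: mono_on_def)
    ultimately show ?thesis using assms(3) by (meson order_trans le_less_trans)
  qed
  have "mono_on {lo..<Suc k} (b(k := a i))"
    by (rule mono_on_snoc) (use d \<open>i < mid\<close> in auto)
  moreover have "(b(k := a i)) ` {lo..<Suc k} = a ` ({lo..<Suc i} \<union> {mid..<j})"
    unfolding image_snoc[OF le] using d by (auto simp: atLeastLessThanSuc)
  moreover have "\<forall>p\<in>{lo..<Suc k}. \<forall>q\<in>{Suc i..<mid} \<union> {j..<hi}. (b(k := a i)) p \<le> a q"
    using d low by (auto simp: less_Suc_eq)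
  ultimately show ?thesis
    using d le \<open>i < mid\<close> by (simp add: merging_def)
qed

lemma merging_right:
  assumes m: "merging a b\<^sub>0 lo mid hi i j k b" and "j < hi" "i < mid \<Longrightarrow> a j \<le> a i"
  shows "merging a b\<^sub>0 lo mid hi i (Suc j) (Suc k) (b(k := a j))"
proof -
  note d = m[unfolded merging_def]
  have le: "lo \<le> k" using d by linarith
  have low: "a j \<le> a q" if "q \<in> {i..<mid} \<union> {j..<hi}" for q
  proof (cases "q < mid")
    case True
    with that d have "i \<le> q" "i < mid" "lo \<le> i" by auto
    moreover from this True d have "a i \<le> a q" by (auto simp: mono_on_def)
    ultimately show ?thesis using assms(3) by (meson order_trans)
  next
    case False
    then show ?thesis using d that \<open>j < hi\<close> by (auto simp: mono_on_def)
  qed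
  have "mono_on {lo..<Suc k} (b(k := a j))"
    by (rule mono_on_snoc) (use d \<open>j < hi\<close> in auto)
  moreover have "(b(k := a j)) ` {lo..<Suc k} = a ` ({lo..<i} \<union> {mid..<Suc j})"
    unfolding image_snoc[OF le] using d by (auto simp: atLeastLessThanSuc)
  moreover have "\<forall>p\<in>{lo..<Suc k}. \<forall>q\<in>{i..<mid} \<union> {Suc j..<hi}. (b(k := a j)) p \<le> a q"
    using d low by (auto simp: less_Suc_eq)
  ultimately show ?thesis
    using d le \<open>j < hi\<close> by (simp add: merging_def)
qed

text \<open>Since \<open>i \<le> mid\<close> and \<open>j \<le> hi\<close>, the balance bounds
  \<open>k\<close> by \<open>hi\<close>, so reaching \<open>hi\<close> forces both runs to be read
  completely.\<close>

lemma merging_final: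
  assumes "merging a b\<^sub>0 lo mid hi i j k b" "hi \<le> k"
  shows "b ` {lo..<hi} = a ` {lo..<hi}" "mono_on {lo..<hi} b" "\<forall>p<lo. b p = b\<^sub>0 p"
proof -
  note d = assms(1)[unfolded merging_def]
  from d assms(2) have "i = mid" "j = hi" "k = hi" by auto
  with d show "b ` {lo..<hi} = a ` {lo..<hi}" "mono_on {lo..<hi} b" "\<forall>p<lo. b p = b\<^sub>0 p"
    by (simp_all add: ivl_disj_un_two)
qed

text \<open>The arrays 0 and 1 hold the points being processed, 2 and 3 the output, and 4 and 5
  scratch space of the merge sort.\<close>

definition pts :: "state \<Rightarrow> nat \<Rightarrow> point" where
  "pts s i = (rarr s 0 i, rarr s 1 i)"

definition out :: "state \<Rightarrow> nat \<Rightarrow> point" where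
  "out s i = (rarr s 2 i, rarr s 3 i)"

definition tmp :: "state \<Rightarrow> nat \<Rightarrow> point" where
  "tmp s i = (rarr s 4 i, rarr s 5 i)"

text \<open>Two coordinate stores at the same index appear as one point update, and stores to other
  arrays disappear. Array 1 is written \<open>Suc 0\<close> because the simplifier normalizes it
  so.\<close>

lemma pts_simps [simp]:
  "pts (nreg_update f s) = pts s" "pts (rreg_update g s) = pts s"
  "pts (s\<lparr>rarr := (rarr t)(4 := u, 5 := v)\<rparr>) = pts t"
  "pts (s\<lparr>rarr := (rarr t)(2 := u, 3 := v)\<rparr>) = pts t"
  "pts (s\<lparr>rarr := (rarr t)(0 := (rarr t 0)(k := x), Suc 0 := (rarr t (Suc 0))(k := y))\<rparr>) =
     (pts t)(k := (x, y))"
  "pts (s\<lparr>rarr := (rarr t)(0 := (rarr t 0)(k := x))\<rparr>) = (pts t)(k := (x, snd (pts t k)))"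
  by (auto simp: pts_def)

lemma tmp_simps [simp]:
  "tmp (nreg_update f s) = tmp s"
  "tmp (s\<lparr>rarr := (rarr t)(0 := u, Suc 0 := v)\<rparr>) = tmp t"
  "tmp (s\<lparr>rarr := (rarr t)(4 := (rarr t 4)(k := x), 5 := (rarr t 5)(k := y))\<rparr>) =
     (tmp t)(k := (x, y))"
  by (auto simp: tmp_def)

lemma out_simps [simp]:
  "out (nreg_update f s) = out s" "out (rreg_update g s) = out s"
  "out (s\<lparr>rarr := (rarr t)(2 := (rarr t 2)(k := x), 3 := (rarr t 3)(k := y))\<rparr>) =
     (out t)(k := (x, y))"
  by (auto simp: out_def)

section \<open>Registers, derived expressions and the merge loop\<close>

abbreviation "nN \<equiv> NReg 0"
abbreviation "nM \<equiv> NReg 1"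
abbreviation "nW \<equiv> NReg 2"
abbreviation "nLo \<equiv> NReg 3"
abbreviation "nMid \<equiv> NReg 4"
abbreviation "nHi \<equiv> NReg 5"
abbreviation "nI \<equiv> NReg 6"
abbreviation "nJ \<equiv> NReg 7"
abbreviation "nK \<equiv> NReg 8"

text \<open>Truncated subtraction yields the minimum without branching; block ends are clipped to
  the number of points this way.\<close>

definition NMin :: "nexp \<Rightarrow> nexp \<Rightarrow> nexp" where
  "NMin e f = NSub e (NSub e f)"

lemma nval_NMin [simp]: "nval (NMin e f) s = min (nval e s) (nval f s)"
  by (auto simp: NMin_def)

lemma ncost_NMin [simp]: "ncost (NMin e f) = 2 * ncost e + ncost f + 2"
  by (simp add: NMin_def)

definition BOr :: "bexp \<Rightarrow> bexp \<Rightarrow> bexp" where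
  "BOr b c = BNot (BAnd (BNot b) (BNot c))"

lemma bval_BOr [simp]: "bval (BOr b c) s \<longleftrightarrow> bval b s \<or> bval c s"
  by (simp add: BOr_def)

lemma bcost_BOr [simp]: "bcost (BOr b c) = bcost b + bcost c + 4"
  by (simp add: BOr_def)

text \<open>Mirrors the order on pairs from \<open>Product_Lexorder\<close>; the weak comparison of
  abscissae is the negation of a strict one, the only kind the machine offers.\<close>

definition pt_less :: "nexp \<Rightarrow> nexp \<Rightarrow> bexp" where
  "pt_less e f = BOr (RLess (RArr 0 e) (RArr 0 f))
     (BAnd (BNot (RLess (RArr 0 f) (RArr 0 e))) (RLess (RArr 1 e) (RArr 1 f)))"

lemma bval_pt_less [simp]: "bval (pt_less e f) s \<longleftrightarrow> pts s (nval e s) < pts s (nval f s)"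
  by (auto simp: pt_less_def pts_def less_prod_def)

lemma bcost_pt_less [simp]: "bcost (pt_less e f) = 3 * ncost e + 3 * ncost f + 15"
  by (simp add: pt_less_def)

definition incr :: "nat \<Rightarrow> com" where
  "incr x = NAssign x (NAdd (NReg x) (NConst 1))"

definition put_tmp :: "nat \<Rightarrow> com" where
  "put_tmp x = Seq (RStore 4 nK (RArr 0 (NReg x))) (Seq (RStore 5 nK (RArr 1 (NReg x))) (incr x))"

definition merge_step :: com where
  "merge_step = Seq (Cond (BAnd (NLess nI nMid) (BNot (BAnd (NLess nJ nHi) (pt_less nJ nI))))
     (put_tmp 6) (put_tmp 7)) (incr 8)"

definition merge_loop :: com where
  "merge_loop = While (NLess nK nHi) merge_step"

abbreviation frame :: "state \<Rightarrow> nat set \<Rightarrow> state \<Rightarrow> bool" where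
  "frame s X s' \<equiv> \<forall>x\<in>X. nreg s' x = nreg s x"

lemma merge_step_correct:
  assumes m: "merging (pts s) b\<^sub>0 lo mid hi (nreg s 6) (nreg s 7) (nreg s 8) (tmp s)"
    and r: "nreg s 4 = mid" "nreg s 5 = hi" "nreg s 8 < hi"
  shows "wp merge_step (\<lambda>_ s'. frame s {0,2,3,4,5} s' \<and> pts s' = pts s \<and>
           nreg s' 8 = Suc (nreg s 8) \<and>
           merging (pts s') b\<^sub>0 lo mid hi (nreg s' 6) (nreg s' 7) (nreg s' 8) (tmp s')) 60 s"
proof -
  \<comment> \<open>Once the left run is exhausted, the balance gives equal write and right read
    positions, so \<open>k < hi\<close> leaves something to read on the right.\<close>
  have right: "nreg s 7 < hi" if "\<not> nreg s 6 < mid"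
    using m r(3) that by (simp add: merging_def)
  have pts: "(rarr s 0 i, rarr s (Suc 0) i) = pts s i" for i
    by (simp add: pts_def)
  show ?thesis
  proof (cases "nreg s 6 < mid \<and> \<not> (nreg s 7 < hi \<and> pts s (nreg s 7) < pts s (nreg s 6))")
    case True
    then show ?thesis
      using merging_left[OF m] r
      by (auto simp: merge_step_def put_tmp_def incr_def wp_simps pts)
  next
    case False
    then show ?thesis
      using merging_right[OF m] r right
      by (auto simp: merge_step_def put_tmp_def incr_def wp_simps pts)
  qed
qed

text \<open>Every loop guard of the program compares two registers; this is the source of the
  summand 4 in the budgets.\<close>

lemma bcost_register_test: "bcost (NLess (NReg x) (NReg y)) + 1 = 4"
  by simp

text \<open>Each iteration is charged 60 for the step and 4 for the guard; the extra 4 pays for the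
  failing guard at the end.\<close>

lemma merge_loop_correct:
  assumes "merging (pts s) (tmp s) lo mid hi (nreg s 6) (nreg s 7) (nreg s 8) (tmp s)"
    and "nreg s 4 = mid" "nreg s 5 = hi" "nreg s 8 = lo"
  shows "wp merge_loop (\<lambda>_ s'. frame s {0,2,3,4,5} s' \<and> pts s' = pts s \<and>
           tmp s' ` {lo..<hi} = pts s ` {lo..<hi} \<and> mono_on {lo..<hi} (tmp s') \<and>
           (\<forall>p<lo. tmp s' p = tmp s p)) (64 * (hi - lo) + 4) s"
proof -
  define I where "I = (\<lambda>k s'. frame s {0,2,3,4,5} s' \<and> pts s' = pts s \<and>
    merging (pts s') (tmp s) lo mid hi (nreg s' 6) (nreg s' 7) (nreg s' 8) (tmp s') \<and>
    64 * (hi - nreg s' 8) + 4 \<le> k)"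
  show ?thesis
    unfolding merge_loop_def
  proof (rule wp_While[where I = I])
    fix k s'
    assume I: "I k s'" and b: "bval (NLess nK nHi) s'"
    have "nreg s' 5 = hi" "nreg s' 4 = mid"
      using I assms unfolding I_def by auto
    with b have lt: "nreg s' 8 < hi" by simp
    with I have k: "64 * (hi - Suc (nreg s' 8)) + 68 \<le> k"
      unfolding I_def by linarith
    have "wp merge_step I (k - 4) s'"
      apply (rule wp_mono[OF merge_step_correct[of s' "tmp s" lo mid hi]])
      using I k lt \<open>nreg s' 5 = hi\<close> \<open>nreg s' 4 = mid\<close> unfolding I_def by auto
    then show "bcost (NLess nK nHi) + 1 \<le> k \<and> wp merge_step I (k - (bcost (NLess nK nHi) + 1)) s'"
      using k unfolding bcost_register_test by simp
  next
    fix k s'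
    assume I: "I k s'" and b: "\<not> bval (NLess nK nHi) s'"
    then have "hi \<le> nreg s' 8" using assms unfolding I_def by auto
    have m: "merging (pts s) (tmp s) lo mid hi (nreg s' 6) (nreg s' 7) (nreg s' 8) (tmp s')"
      using I unfolding I_def by auto
    have "tmp s' ` {lo..<hi} = pts s ` {lo..<hi}" "mono_on {lo..<hi} (tmp s')"
      "\<forall>p<lo. tmp s' p = tmp s p"
      by (rule merging_final[OF m \<open>hi \<le> nreg s' 8\<close>])+
    moreover have "bcost (NLess nK nHi) + 1 \<le> k" "frame s {0,2,3,4,5} s'" "pts s' = pts s"
      using I unfolding I_def by auto
    ultimately show "bcost (NLess nK nHi) + 1 \<le> k \<and> frame s {0,2,3,4,5} s' \<and> pts s' = pts s \<and>
      tmp s' ` {lo..<hi} = pts s ` {lo..<hi} \<and> mono_on {lo..<hi} (tmp s') \<and>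
      (\<forall>p<lo. tmp s' p = tmp s p)"
      by (intro conjI)
  next
    show "I (64 * (hi - lo) + 4) s"
      using assms unfolding I_def by simp
  qed
qed

section \<open>Aligned sorted blocks and the passes that double their width\<close>

definition block_sorted :: "nat \<Rightarrow> nat \<Rightarrow> (nat \<Rightarrow> 'a::linorder) \<Rightarrow> bool" where
  "block_sorted n w a \<longleftrightarrow> (\<forall>m. mono_on ({m * w..<m * w + w} \<inter> {..<n}) a)"

lemma block_sorted_1: "block_sorted n 1 a"
  by (auto simp: block_sorted_def mono_on_def)

lemma block_sorted_total:
  assumes "block_sorted n w a" "n \<le> w"
  shows "mono_on {..<n} a"
proof -
  have "mono_on ({0 * w..<0 * w + w} \<inter> {..<n}) a"
    using assms(1) unfolding block_sorted_def by blast
  also have "{0 * w..<0 * w + w} \<inter> {..<n} = {..<n}"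
    using assms(2) by auto
  finally show ?thesis .
qed

text \<open>A block of width \<open>w + w\<close> consists of the blocks \<open>2 * m\<close> and
  \<open>2 * m + 1\<close> of width \<open>w\<close>. Clipping at \<open>n\<close> treats an
  incomplete last block as one with short or empty halves.\<close>

lemma block_sorted_halves:
  assumes "block_sorted n w a" and "lo = m * (w + w)"
  shows "mono_on {lo..<min (lo + w) n} a" "mono_on {min (lo + w) n..<min (lo + w + w) n} a"
proof -
  have "{lo..<min (lo + w) n} = {(2 * m) * w..<(2 * m) * w + w} \<inter> {..<n}"
    using assms(2) by (auto simp: algebra_simps)
  then show "mono_on {lo..<min (lo + w) n} a"
    using assms(1) unfolding block_sorted_def by metis
  have "{min (lo + w) n..<min (lo + w + w) n} \<subseteq>
      {(2 * m + 1) * w..<(2 * m + 1) * w + w} \<inter> {..<n}"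
    using assms(2) by (auto simp: algebra_simps)
  then show "mono_on {min (lo + w) n..<min (lo + w + w) n} a"
    using assms(1) unfolding block_sorted_def by (metis mono_on_subset)
qed

text \<open>Blocks before number \<open>m\<close> end at or below \<open>lo\<close>, where nothing
  changed; the others meet \<open>{..<hi}\<close> only inside the freshly merged range.\<close>

lemma block_sorted_extend:
  assumes b: "block_sorted lo v b" and lo: "lo = m * v" and hi: "lo < hi" "hi \<le> lo + v"
    and b': "mono_on {lo..<hi} b'" and old: "\<forall>p<lo. b' p = b p"
  shows "block_sorted hi v b'"
  unfolding block_sorted_def
proof
  fix m'
  show "mono_on ({m' * v..<m' * v + v} \<inter> {..<hi}) b'"
  proof (cases "m' < m")
    case True
    then have "Suc m' * v \<le> m * v" by (intro mult_le_mono1) simp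
    then have le: "m' * v + v \<le> lo" using lo by simp
    have "mono_on ({m' * v..<m' * v + v} \<inter> {..<lo}) b"
      using b unfolding block_sorted_def by blast
    then show ?thesis using old le unfolding mono_on_def by auto
  next
    case False
    then have "lo \<le> m' * v" using lo by simp
    then have "{m' * v..<m' * v + v} \<inter> {..<hi} \<subseteq> {lo..<hi}" by auto
    then show ?thesis using b' mono_on_subset by blast
  qed
qed

definition merge_block :: com where
  "merge_block = Seq (NAssign 4 (NMin (NAdd nLo nW) nN)) (Seq (NAssign 5 (NMin (NAdd (NAdd nLo nW) nW) nN))
     (Seq (NAssign 6 nLo) (Seq (NAssign 7 nMid) (Seq (NAssign 8 nLo) (Seq merge_loop (NAssign 3 nHi))))))"

lemma merge_block_correct:
  assumes "nreg s 0 = n" "nreg s 2 = w" "nreg s 3 = lo" "lo < n"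
    and "block_sorted n w (pts s)" "lo = m * (w + w)" "hi = min (lo + w + w) n"
  shows "wp merge_block (\<lambda>_ s'. frame s {0,2} s' \<and> nreg s' 3 = hi \<and> pts s' = pts s \<and>
           tmp s' ` {lo..<hi} = pts s ` {lo..<hi} \<and> mono_on {lo..<hi} (tmp s') \<and>
           (\<forall>p<lo. tmp s' p = tmp s p)) (64 * (hi - lo) + 44) s"
proof -
  define mid where "mid = min (lo + w) n"
  have "lo \<le> mid" "mid \<le> hi"
    using \<open>lo < n\<close> assms(7) unfolding mid_def by auto
  then have m: "merging (pts s) (tmp s) lo mid hi lo mid lo (tmp s)"
    using block_sorted_halves[OF assms(5,6)] unfolding assms(7) mid_def by (intro merging_init)
  show ?thesis
    unfolding merge_block_def
    apply (simp add: wp_simps assms(1-3) mid_def[symmetric] assms(7)[symmetric])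
    apply (rule wp_mono[OF merge_loop_correct[where lo = lo and mid = mid and hi = hi]])
         apply (simp_all add: m)
    by (auto simp: wp_simps assms(1-3))
qed

definition merge_blocks :: com where
  "merge_blocks = While (NLess nLo nN) merge_block"

text \<open>A block has the fixed cost 44 + 4 besides 64 per point. Every block merged contains at
  least one point, so charging the fixed part to its points gives 112 per point, independently of
  \<open>w\<close>.\<close>

lemma merge_blocks_correct:
  assumes "nreg s 0 = n" "nreg s 2 = w" "nreg s 3 = 0" "0 < w" "block_sorted n w (pts s)"
  shows "wp merge_blocks (\<lambda>_ s'. frame s {0,2} s' \<and> pts s' = pts s \<and>
           tmp s' ` {..<n} = pts s ` {..<n} \<and> block_sorted n (w + w) (tmp s')) (112 * n + 4) s"
proof -
  define I where "I = (\<lambda>k s'. frame s {0,2} s' \<and> pts s' = pts s \<and>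
    (\<exists>m. nreg s' 3 = min (m * (w + w)) n) \<and>
    tmp s' ` {..<nreg s' 3} = pts s ` {..<nreg s' 3} \<and>
    block_sorted (nreg s' 3) (w + w) (tmp s') \<and> 112 * (n - nreg s' 3) + 4 \<le> k)"
  show ?thesis
    unfolding merge_blocks_def
  proof (rule wp_While[where I = I])
    fix k s'
    assume I: "I k s'" and b: "bval (NLess nLo nN) s'"
    define lo where "lo = nreg s' 3"
    define hi where "hi = min (lo + w + w) n"
    have lt: "lo < n" and regs: "nreg s' 0 = n" "nreg s' 2 = w"
      using I b assms unfolding I_def lo_def by auto
    with I obtain m where m: "lo = m * (w + w)"
      unfolding I_def lo_def by (auto simp: min_def split: if_splits)
    have hi: "lo < hi" "hi \<le> lo + (w + w)" "hi \<le> n"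
      using lt \<open>0 < w\<close> unfolding hi_def by auto
    have k: "112 * (n - hi) + 112 * (hi - lo) + 4 \<le> k"
      using I hi unfolding I_def lo_def[symmetric] by linarith
    have un: "{..<hi} = {..<lo} \<union> {lo..<hi}" using hi by auto
    have "hi = min (Suc m * (w + w)) n" unfolding hi_def m by (simp add: algebra_simps)
    then have ex: "\<exists>m. hi = min (m * (w + w)) n" by blast
    have "wp merge_block I (k - 4) s'"
    proof (rule wp_mono[OF merge_block_correct[OF regs lo_def[symmetric] lt _ m hi_def]])
      show "block_sorted n w (pts s')" using I assms unfolding I_def by simp
      show "64 * (hi - lo) + 44 \<le> k - 4" using k hi by linarith
      fix s'' k'
      assume s'': "frame s' {0,2} s'' \<and> nreg s'' 3 = hi \<and> pts s'' = pts s' \<and>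
           tmp s'' ` {lo..<hi} = pts s' ` {lo..<hi} \<and> mono_on {lo..<hi} (tmp s'') \<and>
           (\<forall>p<lo. tmp s'' p = tmp s' p)"
        and k': "k - 4 - (64 * (hi - lo) + 44) \<le> k'"
      have "tmp s'' ` {..<lo} = tmp s' ` {..<lo}"
        using s'' by (intro image_cong) auto
      then have "tmp s'' ` {..<hi} = pts s ` {..<hi}"
        using s'' I unfolding un image_Un I_def lo_def[symmetric] by auto
      moreover have "block_sorted hi (w + w) (tmp s'')"
      proof (rule block_sorted_extend[OF _ m hi(1,2)])
        show "block_sorted lo (w + w) (tmp s')" using I unfolding I_def lo_def by (elim conjE)
      qed (use s'' in auto)
      moreover have "112 * (n - hi) + 4 \<le> k'" using k k' hi by linarith
      moreover have "frame s {0,2} s''" "nreg s'' 3 = hi" "pts s'' = pts s"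
        using s'' I unfolding I_def by auto
      ultimately show "I k' s''"
        using ex unfolding I_def by (intro conjI) simp_all
    qed
    then show "bcost (NLess nLo nN) + 1 \<le> k \<and> wp merge_block I (k - (bcost (NLess nLo nN) + 1)) s'"
      using k unfolding bcost_register_test by simp
  next
    fix k s'
    assume "I k s'" "\<not> bval (NLess nLo nN) s'"
    moreover from this have "nreg s' 3 = n"
      using assms unfolding I_def by auto
    ultimately show "bcost (NLess nLo nN) + 1 \<le> k \<and> frame s {0,2} s' \<and> pts s' = pts s \<and>
        tmp s' ` {..<n} = pts s ` {..<n} \<and> block_sorted n (w + w) (tmp s')"
      unfolding I_def by auto
  next
    show "I (112 * n + 4) s"
      using assms unfolding I_def by (auto simp: block_sorted_def intro: exI[of _ 0])
  qed
qed

text \<open>Array names are constants in a program, so source and scratch cannot trade roles at run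
  time; each pass copies its result back.\<close>

definition copy_step :: com where
  "copy_step = Seq (RStore 0 nK (RArr 4 nK)) (Seq (RStore 1 nK (RArr 5 nK)) (incr 8))"

definition copy_loop :: com where
  "copy_loop = While (NLess nK nN) copy_step"

lemma copy_loop_correct:
  assumes "nreg s 0 = n" "nreg s 8 = 0"
  shows "wp copy_loop (\<lambda>_ s'. frame s {0,2} s' \<and> (\<forall>p<n. pts s' p = tmp s p)) (16 * n + 4) s"
proof -
  define I where "I = (\<lambda>k s'. frame s {0,2} s' \<and> tmp s' = tmp s \<and> nreg s' 8 \<le> n \<and>
    (\<forall>p<nreg s' 8. pts s' p = tmp s p) \<and> 16 * (n - nreg s' 8) + 4 \<le> k)"
  have tmp: "(rarr s' 4 p, rarr s' 5 p) = tmp s' p" for s' p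
    by (simp add: tmp_def)
  show ?thesis
    unfolding copy_loop_def
  proof (rule wp_While[where I = I])
    fix k s'
    assume I: "I k s'" and b: "bval (NLess nK nN) s'"
    then have lt: "nreg s' 8 < n" using assms unfolding I_def by auto
    then have k: "16 * (n - Suc (nreg s' 8)) + 20 \<le> k" using I unfolding I_def by linarith
    show "bcost (NLess nK nN) + 1 \<le> k \<and> wp copy_step I (k - (bcost (NLess nK nN) + 1)) s'"
      using I k lt unfolding I_def copy_step_def incr_def
      by (auto simp: wp_simps tmp less_Suc_eq)
  next
    fix k s'
    assume "I k s'" "\<not> bval (NLess nK nN) s'"
    then show "bcost (NLess nK nN) + 1 \<le> k \<and> frame s {0,2} s' \<and> (\<forall>p<n. pts s' p = tmp s p)"
      using assms unfolding I_def by auto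
  next
    show "I (16 * n + 4) s" using assms unfolding I_def by auto
  qed
qed

definition merge_pass :: com where
  "merge_pass = Seq (NAssign 3 (NConst 0)) (Seq merge_blocks
     (Seq (NAssign 8 (NConst 0)) (Seq copy_loop (NAssign 2 (NAdd nW nW)))))"

lemma merge_pass_correct:
  assumes "nreg s 0 = n" "nreg s 2 = w" "0 < w" "block_sorted n w (pts s)"
  shows "wp merge_pass (\<lambda>_ s'. nreg s' 0 = n \<and> nreg s' 2 = w + w \<and>
           pts s' ` {..<n} = pts s ` {..<n} \<and> block_sorted n (w + w) (pts s')) (128 * n + 16) s"
proof -
  have cong: "block_sorted n (w + w) a \<Longrightarrow> \<forall>p<n. b p = a p \<Longrightarrow> block_sorted n (w + w) b"
    for a b :: "nat \<Rightarrow> point"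
    by (auto simp: block_sorted_def mono_on_def)
  have image: "\<forall>p<n. b p = a p \<Longrightarrow> b ` {..<n} = a ` {..<n}" for a b :: "nat \<Rightarrow> point"
    by (intro image_cong) auto
  show ?thesis
    unfolding merge_pass_def
    apply (simp add: wp_simps)
    apply (rule wp_mono[OF merge_blocks_correct[where n = n and w = w]])
    using assms apply (simp_all add: wp_simps)
    apply (rule wp_mono[OF copy_loop_correct[where n = n]])
       apply (simp_all add: wp_simps)
    using cong image by fastforce
qed

definition merge_sort :: com where
  "merge_sort = Seq (NAssign 2 (NConst 1)) (While (NLess nW nN) merge_pass)"

text \<open>The invariant keeps a \<open>q\<close> with \<open>n\<close> at most the current width
  times \<open>2 ^ q\<close>, a bound on the passes still to be paid for. A pass costs
  \<open>128 * n + 16\<close> and its guard 4; the final 6 covers the initial assignment and the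
  failing guard.\<close>

lemma merge_sort_correct:
  assumes "nreg s 0 = n" "n \<le> 2 ^ r"
  shows "wp merge_sort (\<lambda>_ s'. nreg s' 0 = n \<and> pts s' ` {..<n} = pts s ` {..<n} \<and>
           mono_on {..<n} (pts s')) (r * (128 * n + 20) + 6) s"
proof -
  define I where "I = (\<lambda>k s'. nreg s' 0 = n \<and> 0 < nreg s' 2 \<and> pts s' ` {..<n} = pts s ` {..<n} \<and>
    block_sorted n (nreg s' 2) (pts s') \<and>
    (\<exists>q. n \<le> nreg s' 2 * 2 ^ q \<and> q * (128 * n + 20) + 4 \<le> k))"
  have "wp (While (NLess nW nN) merge_pass) (\<lambda>_ s'. nreg s' 0 = n \<and>
      pts s' ` {..<n} = pts s ` {..<n} \<and> mono_on {..<n} (pts s')) (r * (128 * n + 20) + 4)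
      (s\<lparr>nreg := (nreg s)(2 := 1)\<rparr>)"
  proof (rule wp_While[where I = I])
    fix k s'
    assume I: "I k s'" and b: "bval (NLess nW nN) s'"
    then obtain q where q: "n \<le> nreg s' 2 * 2 ^ q" "q * (128 * n + 20) + 4 \<le> k"
      unfolding I_def by blast
    \<comment> \<open>The guard says that the width is still below \<open>n\<close>, so
      \<open>q\<close> can drop by one while the width doubles.\<close>
    moreover have "q \<noteq> 0" using q(1) b I unfolding I_def by (intro notI) simp
    then obtain q' where "q = Suc q'" using not0_implies_Suc by blast
    ultimately have q': "n \<le> (nreg s' 2 + nreg s' 2) * 2 ^ q'"
      "q' * (128 * n + 20) + (128 * n + 20) + 4 \<le> k" by (simp_all add: mult_2[symmetric] mult.assoc mult.left_commute)
    have "wp merge_pass I (k - 4) s'"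
    proof (rule wp_mono[OF merge_pass_correct[where n = n]])
      fix s'' k'
      assume "nreg s'' 0 = n \<and> nreg s'' 2 = nreg s' 2 + nreg s' 2 \<and>
         pts s'' ` {..<n} = pts s' ` {..<n} \<and> block_sorted n (nreg s' 2 + nreg s' 2) (pts s'')"
        and k': "k - 4 - (128 * n + 16) \<le> k'"
      moreover have "q' * (128 * n + 20) + 4 \<le> k'" using q'(2) k' by linarith
      ultimately show "I k' s''" using I q'(1) unfolding I_def by auto
    qed (use I q'(2) in \<open>auto simp: I_def\<close>)
    then show "bcost (NLess nW nN) + 1 \<le> k \<and> wp merge_pass I (k - (bcost (NLess nW nN) + 1)) s'"
      using q'(2) unfolding bcost_register_test by simp
  next
    fix k s'
    assume "I k s'" "\<not> bval (NLess nW nN) s'"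
    then show "bcost (NLess nW nN) + 1 \<le> k \<and> nreg s' 0 = n \<and>
      pts s' ` {..<n} = pts s ` {..<n} \<and> mono_on {..<n} (pts s')"
      using block_sorted_total[of n "nreg s' 2" "pts s'"] unfolding I_def by auto
  next
    show "I (r * (128 * n + 20) + 4) (s\<lparr>nreg := (nreg s)(2 := 1)\<rparr>)"
      using assms block_sorted_1[of n "pts s"] unfolding I_def by auto
  qed
  then show ?thesis
    unfolding merge_sort_def by (simp add: wp_simps add.commute)
qed


section \<open>Greedy strips and squares\<close>

text \<open>\<open>a\<close> is the sorted original, \<open>b\<close> its copy overwritten below
  \<open>k\<close>, and \<open>c\<close> the left edge of the open strip. Edges differ by strictly
  more than 1 because closed squares must not touch.\<close>

definition strip_inv :: "(nat \<Rightarrow> point) \<Rightarrow> nat \<Rightarrow> nat \<Rightarrow> real \<Rightarrow> (nat \<Rightarrow> point) \<Rightarrow> bool" where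
  "strip_inv a n k c b \<longleftrightarrow> k \<le> n \<and> (k < n \<longrightarrow> c \<le> fst (a k)) \<and> (\<forall>p\<ge>k. b p = a p) \<and>
     (\<forall>p<k. fst (b p) \<le> fst (a p) \<and> fst (a p) \<le> fst (b p) + 1 \<and> snd (b p) = snd (a p)) \<and>
     (\<forall>p<k. fst (b p) = c \<or> fst (b p) + 1 < c) \<and>
     (\<forall>p<k. \<forall>q<k. fst (b p) = fst (b q) \<or> 1 < \<bar>fst (b p) - fst (b q)\<bar>)"

lemma strip_inv_step:
  assumes inv: "strip_inv a n k c b" and "k < n" "mono_on {..<n} a"
    and c': "c' = (if c + 1 < fst (a k) then fst (a k) else c)"
  shows "strip_inv a n (Suc k) c' (b(k := (c', snd (a k))))"
proof -
  note d = inv[unfolded strip_inv_def]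
  have c: "c \<le> c'" "c' \<le> fst (a k)" "fst (a k) \<le> c' + 1" "c' = c \<or> c + 1 < c'"
    using d \<open>k < n\<close> c' by auto
  have next': "c' \<le> fst (a (Suc k))" if "Suc k < n"
  proof -
    have "a k \<le> a (Suc k)" using assms(3) that by (auto simp: mono_on_def)
    then show ?thesis using c(2) by (auto simp: less_eq_prod_def)
  qed
  \<comment> \<open>If a new strip opens, \<open>c + 1 < c'\<close>, so the strip just closed and
    all earlier ones start more than 1 to the left of \<open>c'\<close>.\<close>
  have old: "fst (b p) = c' \<or> fst (b p) + 1 < c'" if "p < k" for p
  proof -
    have "fst (b p) = c \<or> fst (b p) + 1 < c" using d that by blast
    then show ?thesis using c by linarith
  qed
  then have sep: "fst (b p) = c' \<or> 1 < \<bar>fst (b p) - c'\<bar>" "c' = fst (b p) \<or> 1 < \<bar>c' - fst (b p)\<bar>"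
    if "p < k" for p
    using that[THEN old] by linarith+
  show ?thesis
    unfolding strip_inv_def using d \<open>k < n\<close> next' c old sep
    by (auto simp: less_Suc_eq)
qed

definition strip_step :: com where
  "strip_step = Seq (Cond (RLess (RAdd (RReg 0) (RConst 1)) (RArr 0 nK)) (RAssign 0 (RArr 0 nK)) Skip)
     (Seq (RStore 0 nK (RReg 0)) (incr 8))"

definition strip_loop :: com where
  "strip_loop = While (NLess nK nN) strip_step"

text \<open>Starting 2 to the left of the first point makes the first test succeed, so the first
  strip begins at that point. On empty input the cell read has no influence, since the loop does not
  run.\<close>

definition strips :: com where
  "strips = Seq (RAssign 0 (RSub (RArr 0 (NConst 0)) (RConst 2)))
     (Seq (NAssign 8 (NConst 0)) strip_loop)"

lemma strip_loop_correct:
  assumes "strip_inv (pts s) n 0 (rreg s 0) (pts s)" "nreg s 0 = n" "nreg s 8 = 0"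
    and "mono_on {..<n} (pts s)"
  shows "wp strip_loop (\<lambda>_ s'. nreg s' 0 = n \<and> (\<exists>c. strip_inv (pts s) n n c (pts s')))
           (25 * n + 4) s"
proof -
  define I where "I = (\<lambda>k s'. nreg s' 0 = n \<and>
    strip_inv (pts s) n (nreg s' 8) (rreg s' 0) (pts s') \<and> 25 * (n - nreg s' 8) + 4 \<le> k)"
  show ?thesis
    unfolding strip_loop_def
  proof (rule wp_While[where I = I])
    fix k s'
    assume I: "I k s'" and "bval (NLess nK nN) s'"
    then have lt: "nreg s' 8 < n" unfolding I_def by auto
    then have k: "25 * (n - Suc (nreg s' 8)) + 29 \<le> k" using I unfolding I_def by linarith
    have inv: "strip_inv (pts s) n (nreg s' 8) (rreg s' 0) (pts s')"
      using I unfolding I_def by simp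
    then have eq: "pts s (nreg s' 8) = pts s' (nreg s' 8)"
      unfolding strip_inv_def by auto
    \<comment> \<open>A point that opens a strip has its own abscissa stored back, which changes
      nothing.\<close>
    have triv: "(pts s')(i := (rarr s' 0 i, rarr s' (Suc 0) i)) = pts s'" for i
      by (auto simp: pts_def)
    have "wp strip_step I (k - 4) s'"
      using strip_inv_step[OF inv lt assms(4) refl] k I unfolding I_def eq
      by (auto simp: strip_step_def incr_def wp_simps triv pts_def[of s' "nreg s' 8"])
    then show "bcost (NLess nK nN) + 1 \<le> k \<and> wp strip_step I (k - (bcost (NLess nK nN) + 1)) s'"
      using k unfolding bcost_register_test by simp
  next
    fix k s'
    assume I: "I k s'" and "\<not> bval (NLess nK nN) s'"
    moreover from this have "nreg s' 8 = n"
      unfolding I_def strip_inv_def by auto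
    ultimately show "bcost (NLess nK nN) + 1 \<le> k \<and> nreg s' 0 = n \<and>
        (\<exists>c. strip_inv (pts s) n n c (pts s'))"
      unfolding I_def by auto
  next
    show "I (25 * n + 4) s" using assms unfolding I_def by auto
  qed
qed

lemma strips_correct:
  assumes "nreg s 0 = n" "mono_on {..<n} (pts s)"
  shows "wp strips (\<lambda>_ s'. nreg s' 0 = n \<and> (\<exists>c. strip_inv (pts s) n n c (pts s'))) (25 * n + 11) s"
proof -
  have "strip_inv (pts s) n 0 (rarr s 0 0 - 2) (pts s)"
    by (simp add: strip_inv_def pts_def)
  then show ?thesis
    unfolding strips_def
    apply (simp add: wp_simps)
    apply (rule wp_mono[OF strip_loop_correct[where n = n]])
    using assms by auto
qed

section \<open>The upward sweep that emits the lower left corners\<close>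

definition emit_inv :: "(nat \<Rightarrow> point) \<Rightarrow> nat \<Rightarrow> nat \<Rightarrow> nat \<Rightarrow> point \<Rightarrow> (nat \<Rightarrow> point) \<Rightarrow> bool" where
  "emit_inv a n k m l b \<longleftrightarrow> k \<le> n \<and> b ` {..<m} \<subseteq> a ` {..<n} \<and> (\<forall>p<m. b p \<le> l) \<and>
     (\<forall>p<m. \<forall>q<m. p \<noteq> q \<longrightarrow> fst (b p) \<noteq> fst (b q) \<or> 1 < \<bar>snd (b p) - snd (b q)\<bar>) \<and>
     (\<forall>p<k. \<exists>q<m. fst (b q) = fst (a p) \<and> snd (b q) \<le> snd (a p) \<and> snd (a p) \<le> snd (b q) + 1) \<and>
     (k < n \<longrightarrow> l \<in> b ` {..<m} \<and> l \<le> a k \<or> k = 0 \<and> m = 0 \<and> fst l < fst (a 0))"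

text \<open>Comparing with \<open>l\<close> alone suffices: a corner \<open>b p\<close> with the
  abscissa of \<open>a k\<close> satisfies \<open>b p \<le> l \<le> a k\<close>, which squeezes
  \<open>l\<close> into the same strip. Then \<open>snd (b p) \<le> snd l\<close>, and the gap above
  \<open>l\<close> is a gap above \<open>b p\<close>.\<close>

lemma emit_inv_put:
  assumes inv: "emit_inv a n k m l b" and "k < n" "mono_on {..<n} a"
    and new: "fst l < fst (a k) \<or> snd l + 1 < snd (a k)"
  shows "emit_inv a n (Suc k) (Suc m) (a k) (b(m := a k))"
proof -
  note d = inv[unfolded emit_inv_def]
  have old: "b p \<le> a k \<and> (fst (b p) \<noteq> fst (a k) \<or> 1 < snd (a k) - snd (b p))" if "p < m" for p
  proof -
    have "b p \<le> l" "l \<le> a k" using d that \<open>k < n\<close> by auto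
    then show ?thesis using new by (auto simp: less_eq_prod_def)
  qed
  have sep: "fst (b p) \<noteq> fst (a k) \<or> 1 < \<bar>snd (b p) - snd (a k)\<bar>"
    "fst (a k) \<noteq> fst (b p) \<or> 1 < \<bar>snd (a k) - snd (b p)\<bar>" if "p < m" for p
    using old[OF that] by auto
  have cov: "\<exists>q<Suc m. fst ((b(m := a k)) q) = fst (a p) \<and> snd ((b(m := a k)) q) \<le> snd (a p) \<and>
      snd (a p) \<le> snd ((b(m := a k)) q) + 1" if "p < Suc k" for p
  proof (cases "p = k")
    case True
    then show ?thesis by (intro exI[of _ m]) simp
  next
    case False
    with that have "p < k" by simp
    with d obtain q where "q < m" "fst (b q) = fst (a p)" "snd (b q) \<le> snd (a p)"
      "snd (a p) \<le> snd (b q) + 1" by blast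
    then show ?thesis by (intro exI[of _ q]) simp
  qed
  have "a k \<le> a (Suc k)" if "Suc k < n"
    using assms(3) that by (auto simp: mono_on_def)
  moreover have "(b(m := a k)) ` {..<Suc m} \<subseteq> a ` {..<n}"
    using d \<open>k < n\<close> by (auto simp: less_Suc_eq)
  moreover have "a k \<in> (b(m := a k)) ` {..<Suc m}"
    by (rule image_eqI[of _ _ m]) auto
  moreover have "\<forall>p<Suc m. \<forall>q<Suc m. p \<noteq> q \<longrightarrow>
      fst ((b(m := a k)) p) \<noteq> fst ((b(m := a k)) q) \<or> 1 < \<bar>snd ((b(m := a k)) p) - snd ((b(m := a k)) q)\<bar>"
    using d sep by (auto simp: less_Suc_eq)
  moreover have "\<forall>p<Suc m. (b(m := a k)) p \<le> a k"
    using old by (auto simp: less_Suc_eq)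
  ultimately show ?thesis
    unfolding emit_inv_def using cov \<open>k < n\<close> by (intro conjI) auto
qed

text \<open>The failed test excludes the fictitious initial corner, so \<open>l\<close> is a real
  output corner. With \<open>l \<le> a k\<close> it also forces equal abscissae, hence the square at
  \<open>l\<close> already reaches \<open>a k\<close>.\<close>

lemma emit_inv_skip:
  assumes inv: "emit_inv a n k m l b" and "k < n" "mono_on {..<n} a"
    and skip: "\<not> (fst l < fst (a k) \<or> snd l + 1 < snd (a k))"
  shows "emit_inv a n (Suc k) m l b"
proof -
  note d = inv[unfolded emit_inv_def]
  have l: "l \<in> b ` {..<m}" "l \<le> a k" using d \<open>k < n\<close> skip by auto
  from l(1) obtain q where q: "q < m" "l = b q" by auto
  have "fst l = fst (a k)" "snd l \<le> snd (a k)" "snd (a k) \<le> snd l + 1"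
    using l(2) skip by (auto simp: less_eq_prod_def)
  then have "\<exists>q<m. fst (b q) = fst (a k) \<and> snd (b q) \<le> snd (a k) \<and> snd (a k) \<le> snd (b q) + 1"
    using q by blast
  moreover have "l \<le> a (Suc k)" if "Suc k < n"
  proof -
    have "a k \<le> a (Suc k)" using assms(3) that by (auto simp: mono_on_def)
    with l(2) show ?thesis by (rule order_trans)
  qed
  ultimately show ?thesis
    unfolding emit_inv_def using d l(1) \<open>k < n\<close> by (auto simp: less_Suc_eq)
qed

text \<open>Sorted order rules out a point left of the last corner, so a failed first test means
  equal abscissae and the second test then compares within one strip.\<close>

definition emit_step :: com where
  "emit_step = Seq (Cond (BOr (RLess (RReg 0) (RArr 0 nK)) (RLess (RAdd (RReg 1) (RConst 1)) (RArr 1 nK)))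
     (Seq (RAssign 0 (RArr 0 nK)) (Seq (RAssign 1 (RArr 1 nK))
       (Seq (RStore 2 nM (RReg 0)) (Seq (RStore 3 nM (RReg 1)) (incr 1))))) Skip) (incr 8)"

definition emit_loop :: com where
  "emit_loop = While (NLess nK nN) emit_step"

text \<open>The fictitious last corner starts left of all points, so the first point is always emitted.\<close>

definition emit :: com where
  "emit = Seq (RAssign 0 (RSub (RArr 0 (NConst 0)) (RConst 2)))
     (Seq (NAssign 1 (NConst 0)) (Seq (NAssign 8 (NConst 0)) emit_loop))"

lemma emit_loop_correct:
  assumes "emit_inv (pts s) n 0 0 (rreg s 0, rreg s 1) (out s)" "nreg s 0 = n" "nreg s 8 = 0"
    "nreg s 1 = 0" and "mono_on {..<n} (pts s)"
  shows "wp emit_loop (\<lambda>_ s'. \<exists>l. emit_inv (pts s) n n (nreg s' 1) l (out s')) (40 * n + 4) s"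
proof -
  define I where "I = (\<lambda>k s'. nreg s' 0 = n \<and> pts s' = pts s \<and>
    emit_inv (pts s) n (nreg s' 8) (nreg s' 1) (rreg s' 0, rreg s' 1) (out s') \<and>
    40 * (n - nreg s' 8) + 4 \<le> k)"
  show ?thesis
    unfolding emit_loop_def
  proof (rule wp_While[where I = I])
    fix k s'
    assume I: "I k s'" and "bval (NLess nK nN) s'"
    then have lt: "nreg s' 8 < n" unfolding I_def by auto
    then have k: "40 * (n - Suc (nreg s' 8)) + 44 \<le> k" using I unfolding I_def by linarith
    have inv: "emit_inv (pts s) n (nreg s' 8) (nreg s' 1) (rreg s' 0, rreg s' 1) (out s')"
      and pts: "pts s' = pts s" and n: "nreg s' 0 = n"
      using I unfolding I_def by simp_all
    have cell: "pts s (nreg s' 8) = (rarr s' 0 (nreg s' 8), rarr s' 1 (nreg s' 8))"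
      unfolding pts[symmetric] by (simp add: pts_def)
    have "wp emit_step I (k - 4) s'"
    proof (cases "rreg s' 0 < rarr s' 0 (nreg s' 8) \<or> rreg s' 1 + 1 < rarr s' 1 (nreg s' 8)")
      case True
      then show ?thesis
        using emit_inv_put[OF inv lt assms(5)] k unfolding I_def cell
        by (auto simp: emit_step_def incr_def wp_simps pts n)
    next
      case False
      then show ?thesis
        using emit_inv_skip[OF inv lt assms(5)] k unfolding I_def cell
        by (auto simp: emit_step_def incr_def wp_simps pts n)
    qed
    then show "bcost (NLess nK nN) + 1 \<le> k \<and> wp emit_step I (k - (bcost (NLess nK nN) + 1)) s'"
      using k unfolding bcost_register_test by simp
  next
    fix k s'
    assume I: "I k s'" and "\<not> bval (NLess nK nN) s'"
    moreover from this have "nreg s' 8 = n"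
      unfolding I_def emit_inv_def by auto
    ultimately show "bcost (NLess nK nN) + 1 \<le> k \<and>
        (\<exists>l. emit_inv (pts s) n n (nreg s' 1) l (out s'))"
      unfolding I_def by auto
  next
    show "I (40 * n + 4) s" using assms unfolding I_def by auto
  qed
qed

lemma emit_correct:
  assumes "nreg s 0 = n" "mono_on {..<n} (pts s)"
  shows "wp emit (\<lambda>_ s'. \<exists>l. emit_inv (pts s) n n (nreg s' 1) l (out s')) (40 * n + 13) s"
proof -
  have "emit_inv (pts s) n 0 0 (rarr s 0 0 - 2, rreg s 1) (out s)"
    by (simp add: emit_inv_def pts_def)
  then show ?thesis
    unfolding emit_def
    apply (simp add: wp_simps)
    apply (rule wp_mono[OF emit_loop_correct[where n = n]])
    using assms by auto
qed


section \<open>The cover\<close>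

lemma one_ply_unit_square_coverI:
  assumes "finite Q" "P \<subseteq> \<Union>(unit_square ` Q)"
    and sep: "\<And>u v. u \<in> Q \<Longrightarrow> v \<in> Q \<Longrightarrow> u \<noteq> v \<Longrightarrow>
      1 < \<bar>fst u - fst v\<bar> \<or> 1 < \<bar>snd u - snd v\<bar>"
  shows "one_ply_unit_square_cover P (unit_square ` Q)"
proof -
  have le: "card {s \<in> unit_square ` Q. p \<in> s} \<le> 1" for p
  proof -
    have "u = v" if "u \<in> Q" "v \<in> Q" "p \<in> unit_square u" "p \<in> unit_square v" for u v
    proof (rule ccontr)
      assume "u \<noteq> v"
      then have "1 < \<bar>fst u - fst v\<bar> \<or> 1 < \<bar>snd u - snd v\<bar>" using sep that by blast
      then show False using that(3,4) by (cases p) (auto simp: unit_square_def)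
    qed
    then have "\<forall>s\<in>{s \<in> unit_square ` Q. p \<in> s}. \<forall>t\<in>{s \<in> unit_square ` Q. p \<in> s}. s = t"
      by blast
    then show ?thesis
      using \<open>finite Q\<close> by (simp add: card_le_Suc0_iff_eq)
  qed
  \<comment> \<open>\<open>Max\<close> is meaningful only on finite sets, so the pointwise bound has
    to give finiteness of the range before it bounds \<open>ply\<close>.\<close>
  then have "finite (range (\<lambda>p. card {s \<in> unit_square ` Q. p \<in> s}))"
    by (intro finite_subset[OF _ finite_atMost[of 1]]) auto
  then have "ply (unit_square ` Q) \<le> 1"
    unfolding ply_def using le by (subst Max_le_iff) auto
  then show ?thesis
    using assms unfolding one_ply_unit_square_cover_def by auto
qed

text \<open>The sequences are the sorted input \<open>a\<close>, its overwritten copy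
  \<open>b\<close>, the second sort \<open>d\<close> and the corners \<open>e\<close>. Corners with
  different abscissae are apart by \<open>strip_inv\<close>, those with equal ones by
  \<open>emit_inv\<close>. Horizontal coverage comes from \<open>a\<close> versus \<open>b\<close>,
  vertical coverage from \<open>d\<close> versus \<open>e\<close>, as overwriting keeps
  ordinates.\<close>

lemma greedy_cover:
  assumes sub: "P = a ` {..<n}" and strip: "strip_inv a n n c b"
    and perm: "d ` {..<n} = b ` {..<n}" and emit: "emit_inv d n n m l e"
  shows "inj_on e {..<m}" "one_ply_unit_square_cover P (unit_square ` e ` {..<m})"
proof -
  note s = strip[unfolded strip_inv_def] and g = emit[unfolded emit_inv_def]
  have dist: "1 < \<bar>fst (e p) - fst (e q)\<bar> \<or> 1 < \<bar>snd (e p) - snd (e q)\<bar>"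
    if "p < m" "q < m" "p \<noteq> q" for p q
  proof -
    have "e p \<in> b ` {..<n}" "e q \<in> b ` {..<n}" using g perm that by auto
    then obtain i j where "i < n" "e p = b i" "j < n" "e q = b j" by blast
    then have "fst (e p) = fst (e q) \<or> 1 < \<bar>fst (e p) - fst (e q)\<bar>" using s by metis
    with g that show ?thesis by blast
  qed
  show "inj_on e {..<m}"
    using dist by (intro inj_onI) fastforce
  have "x \<in> \<Union>(unit_square ` e ` {..<m})" if "x \<in> P" for x
  proof -
    from that sub obtain p where p: "p < n" "x = a p" by auto
    then have "b p \<in> d ` {..<n}" using perm by auto
    then obtain q where q: "q < n" "b p = d q" by auto
    with g obtain r where r: "r < m" "fst (e r) = fst (b p)" "snd (e r) \<le> snd (b p)"
      "snd (b p) \<le> snd (e r) + 1" by metis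
    have "fst (b p) \<le> fst (a p) \<and> fst (a p) \<le> fst (b p) + 1 \<and> snd (b p) = snd (a p)"
      using s p by blast
    with r p have "x \<in> unit_square (e r)"
      by (cases "a p") (auto simp: unit_square_def)
    then show ?thesis using r(1) by blast
  qed
  then show "one_ply_unit_square_cover P (unit_square ` e ` {..<m})"
  proof (intro one_ply_unit_square_coverI)
    fix u v
    assume "u \<in> e ` {..<m}" "v \<in> e ` {..<m}" "u \<noteq> v"
    then obtain p q where "p < m" "q < m" "u = e p" "v = e q" "p \<noteq> q" by blast
    with dist show "1 < \<bar>fst u - fst v\<bar> \<or> 1 < \<bar>snd u - snd v\<bar>" by blast
  qed auto
qed

section \<open>The complete program and its running time\<close>

definition greedy :: com where
  "greedy = Seq merge_sort (Seq strips (Seq merge_sort emit))"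

definition passes :: "nat \<Rightarrow> nat" where
  "passes n = nat \<lceil>log 2 (real n)\<rceil>"

text \<open>The sum of the four budgets: two sorts with 6 extra each, \<open>25 * n + 11\<close> for
  the strips and \<open>40 * n + 13\<close> for the emission.\<close>

definition greedy_time :: "nat \<Rightarrow> nat" where
  "greedy_time n = 2 * (passes n * (128 * n + 20)) + 65 * n + 36"

lemma le_two_power_passes: "n \<le> 2 ^ passes n"
proof (cases "n = 0")
  case False
  then have "real n = 2 powr log 2 (real n)" by simp
  also have "\<dots> \<le> 2 powr real (passes n)"
    unfolding passes_def by (intro powr_mono) linarith+
  also have "\<dots> = real (2 ^ passes n)" by (simp add: powr_realpow)
  finally show ?thesis by linarith
qed simp

text \<open>The bound can hold only eventually: for \<open>n\<close> at most 1 the comparison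
  function is 0, whereas the time is positive.\<close>

lemma greedy_time_bigo: "(\<lambda>n. real (greedy_time n)) \<in> O(\<lambda>n. real n * ln (real n))"
proof -
  have "eventually (\<lambda>n. norm (real (greedy_time n)) \<le>
      norm (2 * ((ln (real n) / ln 2 + 1) * (128 * real n + 20)) + 65 * real n + 36)) sequentially"
    using eventually_ge_at_top[of 1]
  proof eventually_elim
    case (elim n)
    \<comment> \<open>For \<open>n \<ge> 1\<close> the logarithm is nonnegative, so
      \<open>nat\<close> does not truncate and rounding up costs at most 1.\<close>
    have nn: "0 \<le> log 2 (real n)" using elim by simp
    then have "real (passes n) \<le> ln (real n) / ln 2 + 1"
      unfolding passes_def log_def by linarith
    then have "real (passes n) * (128 * real n + 20) \<le> (ln (real n) / ln 2 + 1) * (128 * real n + 20)"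
      by (intro mult_right_mono) auto
    then show ?case unfolding greedy_time_def by simp
  qed
  then have "(\<lambda>n. real (greedy_time n)) \<in>
      O(\<lambda>n. 2 * ((ln (real n) / ln 2 + 1) * (128 * real n + 20)) + 65 * real n + 36)"
    by (rule landau_o.big_mono)
  also have "(\<lambda>n. 2 * ((ln (real n) / ln 2 + 1) * (128 * real n + 20)) + 65 * real n + 36) \<in>
      O(\<lambda>n. real n * ln (real n))"
    by real_asymp
  finally show ?thesis .
qed

lemma greedy_correct:
  assumes "nreg s 0 = n"
  shows "wp greedy (\<lambda>_ s'. inj_on (out s') {..<nreg s' 1} \<and>
           one_ply_unit_square_cover (pts s ` {..<n}) (unit_square ` out s' ` {..<nreg s' 1}))
           (greedy_time n) s"
  unfolding greedy_def wp_Seq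
proof (rule wp_mono[OF merge_sort_correct[OF assms le_two_power_passes]])
  \<comment> \<open>Naming the nonlinear product keeps the credit arithmetic below within linear
    reasoning.\<close>
  define M where "M = passes n * (128 * n + 20)"
  have time: "greedy_time n = 2 * M + 65 * n + 36"
    by (simp add: greedy_time_def M_def)
  note sort = merge_sort_correct[OF _ le_two_power_passes, of _ n, folded M_def]
  show "passes n * (128 * n + 20) + 6 \<le> greedy_time n"
    unfolding greedy_time_def by simp
  fix s1 k1
  assume 1: "nreg s1 0 = n \<and> pts s1 ` {..<n} = pts s ` {..<n} \<and> mono_on {..<n} (pts s1)"
    and "greedy_time n - (passes n * (128 * n + 20) + 6) \<le> k1"
  then have k1: "M + 65 * n + 30 \<le> k1" unfolding time M_def[symmetric] by linarith
  show "wp strips (wp merge_sort (wp emit (\<lambda>_ s'. inj_on (out s') {..<nreg s' 1} \<and>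
      one_ply_unit_square_cover (pts s ` {..<n}) (unit_square ` out s' ` {..<nreg s' 1})))) k1 s1"
  proof (rule wp_mono[OF strips_correct[of s1 n]])
    show "25 * n + 11 \<le> k1" using k1 by linarith
    fix s2 k2
    assume 2: "nreg s2 0 = n \<and> (\<exists>c. strip_inv (pts s1) n n c (pts s2))"
      and "k1 - (25 * n + 11) \<le> k2"
    then have k2: "M + 40 * n + 19 \<le> k2" using k1 by linarith
    show "wp merge_sort (wp emit (\<lambda>_ s'. inj_on (out s') {..<nreg s' 1} \<and>
      one_ply_unit_square_cover (pts s ` {..<n}) (unit_square ` out s' ` {..<nreg s' 1}))) k2 s2"
    proof (rule wp_mono[OF sort[of s2]])
      show "M + 6 \<le> k2" using k2 by linarith
      fix s3 k3
      assume 3: "nreg s3 0 = n \<and> pts s3 ` {..<n} = pts s2 ` {..<n} \<and> mono_on {..<n} (pts s3)"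
        and "k2 - (M + 6) \<le> k3"
      then have k3: "40 * n + 13 \<le> k3" using k2 by linarith
      show "wp emit (\<lambda>_ s'. inj_on (out s') {..<nreg s' 1} \<and>
        one_ply_unit_square_cover (pts s ` {..<n}) (unit_square ` out s' ` {..<nreg s' 1})) k3 s3"
      proof (rule wp_mono[OF emit_correct[of s3 n] k3])
        fix s4 k4
        assume 4: "\<exists>l. emit_inv (pts s3) n n (nreg s4 1) l (out s4)"
        have P: "pts s ` {..<n} = pts s1 ` {..<n}" and d: "pts s3 ` {..<n} = pts s2 ` {..<n}"
          using 1 3 by auto
        from 2 4 obtain c l where "strip_inv (pts s1) n n c (pts s2)"
          "emit_inv (pts s3) n n (nreg s4 1) l (out s4)" by blast
        from greedy_cover[OF P this(1) d this(2)]
        show "inj_on (out s4) {..<nreg s4 1} \<and>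
          one_ply_unit_square_cover (pts s ` {..<n}) (unit_square ` out s4 ` {..<nreg s4 1})"
          by blast
      qed (use 3 in auto)
    qed (use 2 in auto)
  qed (use 1 in auto)
qed

lemma greedy_computes: "computes_one_ply_cover_in_time greedy greedy_time"
  unfolding computes_one_ply_cover_in_time_def
proof (intro allI impI)
  fix n P and ps :: "point list"
  assume "finite P \<and> card P = n \<and> set ps = P \<and> distinct ps"
  then have n: "n = length ps" and P: "P = set ps"
    using distinct_card[of ps] by auto
  have "pts (input_state ps) i = ps ! i" if "i < n" for i
    using that n by (simp add: pts_def input_state_def)
  then have "pts (input_state ps) ` {..<n} = (!) ps ` {..<n}"
    by (intro image_cong) auto
  also have "\<dots> = P"
    unfolding P n by (auto simp: set_conv_nth)
  finally have pts: "pts (input_state ps) ` {..<n} = P" .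
  have "nreg (input_state ps) 0 = n" by (simp add: input_state_def n)
  from greedy_correct[OF this, unfolded pts] obtain t s where
    "exec greedy (input_state ps) t s" "t \<le> greedy_time n" "inj_on (out s) {..<nreg s 1}"
    "one_ply_unit_square_cover P (unit_square ` out s ` {..<nreg s 1})"
    unfolding wp_def by blast
  \<comment> \<open>With this form, injectivity of \<open>out\<close> on the used indices becomes
    repetition-freeness of the returned list.\<close>
  moreover have "output_list s = map (out s) [0..<nreg s 1]"
    by (simp add: output_list_def out_def)
  ultimately show "\<exists>t s. exec greedy (input_state ps) t s \<and> t \<le> greedy_time n \<and>
      distinct (output_list s) \<and> one_ply_unit_square_cover P (unit_square ` set (output_list s))"
    by (intro exI[of _ t] exI[of _ s]) (simp add: distinct_map atLeast0LessThan)
qed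

theorem theorem1:
  "\<exists>(c :: com) (T :: nat \<Rightarrow> nat).
     (\<lambda>n. real (T n)) \<in> O(\<lambda>n. real n * ln (real n)) \<and>
     computes_one_ply_cover_in_time c T"
  using greedy_time_bigo greedy_computes by blast

end
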